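(* Let $\alpha>0$, $\beta>0$, let $r$ be a positive integer, let $\varepsilon\in(0,1)$, and let the SNR $\gamma$ be a random variable with $\gamma\sim\Gamma(\alpha,\beta)$ (shape $\alpha$, rate $\beta$). Let $$\bar R(L,\varepsilon)=\mathbb{E}\left[\mathrm{C}(\gamma)-Q^{-1}(\varepsilon)\sqrt{\frac{\mathrm{V}(\gamma)}{r}}\right]$$ be the average achievable rate at blocklength $r$ and target error probability $\varepsilon$, the expectation being over the distribution of $\gamma$. Then $$\bar R(L,\varepsilon)=\mathcal{C}_1-\frac{Q^{-1}(\varepsilon)}{\sqrt r}\,\mathcal{C}_2,$$ where $$\mathcal{C}_1=\mathbb{E}[\log_2(1+\gamma)]=\frac{\beta^{\alpha}}{\Gamma(\alpha)\ln 2}\sum_{k=1}^{\infty}\frac{1}{k}\,\Gamma(k+\alpha)\,\mathbf{U}(k+\alpha,1+\alpha,\beta),$$ $$\mathcal{C}_2=\mathbb{E}\left[\sqrt{\mathrm{V}(\gamma)}\right]=\frac{\beta^{\alpha}}{\ln 2}\sum_{k=0}^{\infty}\binom{\frac12}{k}(-1)^k\,\mathbf{U}(\alpha,1-2k+\alpha,\beta).$$ That is, $$\bar R(L,\varepsilon)=\frac{\beta^{\alpha}}{\Gamma(\alpha)\ln 2}\sum_{k=1}^{\infty}\frac{1}{k}\Gamma(k+\alpha)\mathbf{U}(k+\alpha,1+\alpha,\beta)-\frac{Q^{-1}(\varepsilon)\beta^{\alpha}}{\sqrt r\,\ln 2}\sum_{k=0}^{\infty}\binom{\frac12}{k}(-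1)^k\,\mathbf{U}(\alpha,1-2k+\alpha,\beta).$$
   Context: Notation. $\gamma\sim\Gamma(\alpha,\beta)$ means that $\gamma$ has density $f_\gamma(u)=\frac{\beta^{\alpha}u^{\alpha-1}e^{-\beta u}}{\Gamma(\alpha)}$ on $u>0$. $\Gamma(\alpha)=\int_0^\infty y^{\alpha-1}e^{-y}\,dy$ is the Gamma function. $\mathrm{C}(\gamma)=\log_2(1+\gamma)$ is the Shannon capacity, and $\mathrm{V}(\gamma)=(\log_2 e)^2\left(1-\frac{1}{(1+\gamma)^2}\right)$ is the channel dispersion. $Q(x)=\frac{1}{\sqrt{2\pi}}\int_x^\infty e^{-\nu^2/2}\,d\nu$, and $Q^{-1}$ is its inverse function on $(0,1)$. The confluent hypergeometric Kummer U function is, for $a>0$, $z>0$ and real $b$, $$\mathbf{U}(a,b,z)=\frac{1}{\Gamma(a)}\int_0^\infty (1+u)^{b-a-1}u^{a-1}e^{-zu}\,du.$$ The generalized binomial coefficients are $\binom{1/2}{0}=1$ and $\binom{1/2}{k}=\frac{\frac12(\frac12-1)\cdots(\frac12-k+1)}{k!}$ for $k\ge 1$. Setting. $\gamma$ is the received SNR of a reconfigurable-intelligent-surface-aided link, and the instantaneous achievable rate in the finite blocklength regime ($r$ channel uses, packet of $L$ bits, target error probability $\varepsilon$) is taken to be $R^*(\gamma,L,\varepsilon)=\mathrm{C}(\gamma)-Q^{-1}(\varepsilon)\sqrt{\mathrm{V}(\gamma)/r}$. The argument $L$ in $\bar R(L,\varepsilon)$ is purely notational: it does not appear in the expression being averaged.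 *)

theory Defs
  imports "HOL-Probability.Probability"
begin

definition gamma_density :: "real \<Rightarrow> real \<Rightarrow> real \<Rightarrow> real" where
  "gamma_density \<alpha> \<beta> u =
     (if u > 0 then \<beta> powr \<alpha> * u powr (\<alpha> - 1) * exp (- \<beta> * u) / Gamma \<alpha> else 0)"

definition capacity :: "real \<Rightarrow> real" where
  "capacity g = log 2 (1 + g)"

definition dispersion :: "real \<Rightarrow> real" where
  "dispersion g = (log 2 (exp 1))\<^sup>2 * (1 - 1 / (1 + g)\<^sup>2)"

definition Q_fun :: "real \<Rightarrow> real" where
  "Q_fun x = 1 / sqrt (2 * pi) * (LINT v:{x<..}|lborel. exp (- v\<^sup>2 / 2))"

text \<open>\<open>Q_fun\<close> is a strictly decreasing bijection from the real line onto the open unit interval;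
  the value of \<open>Q_inv\<close> is meaningful only there.\<close>

definition Q_inv :: "real \<Rightarrow> real" where
  "Q_inv = inv Q_fun"

text \<open>The defining integral converges for \<open>a > 0\<close>, \<open>z > 0\<close> and arbitrary real \<open>b\<close>; outside this
  range the value is not meaningful.\<close>

definition kummer_U :: "real \<Rightarrow> real \<Rightarrow> real \<Rightarrow> real" where
  "kummer_U a b z = 1 / Gamma a *
     (LINT u:{0<..}|lborel. (1 + u) powr (b - a - 1) * u powr (a - 1) * exp (- z * u))"

text \<open>Normal-approximation rate for \<open>r\<close> channel uses and error probability \<open>\<epsilon>\<close> at SNR \<open>g\<close>.
  The packet size does not enter the expression, so it is not a parameter.\<close>

definition achievable_rate :: "nat \<Rightarrow> real \<Rightarrow> real \<Rightarrow> real" where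
  "achievable_rate r \<epsilon> g = capacity g - Q_inv \<epsilon> * sqrt (dispersion g / real r)"

definition average_rate :: "'a measure \<Rightarrow> ('a \<Rightarrow> real) \<Rightarrow> nat \<Rightarrow> real \<Rightarrow> real" where
  "average_rate M \<gamma> r \<epsilon> = (\<integral>\<omega>. achievable_rate r \<epsilon> (\<gamma> \<omega>) \<partial>M)"

text \<open>The index of the first series is shifted by one: it starts at \<open>k = 1\<close> in the usual form.\<close>

definition C1_term :: "real \<Rightarrow> real \<Rightarrow> nat \<Rightarrow> real" where
  "C1_term \<alpha> \<beta> n = (let k = real (Suc n) in
     1 / k * Gamma (k + \<alpha>) * kummer_U (k + \<alpha>) (1 + \<alpha>) \<beta>)"

definition C2_term :: "real \<Rightarrow> real \<Rightarrow> nat \<Rightarrow> real" where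
  "C2_term \<alpha> \<beta> k = ((1 / 2) gchoose k) * (- 1) ^ k * kummer_U \<alpha> (1 - 2 * real k + \<alpha>) \<beta>"

end

theory Submission
  imports Defs
begin

text \<open>Put \<open>x = u / (1 + u)\<close> and \<open>t = 1 / (1 + u)\<^sup>2\<close>. The logarithm series gives
  \<open>ln (1 + u) = (\<Sum>k\<ge>1. x ^ k / k)\<close> and the binomial series gives
  \<open>sqrt (1 - t) = (\<Sum>k. ((1/2) gchoose k) * (- t) ^ k)\<close>. Integrating either series term by term
  against the Gamma density produces Kummer functions. All terms of the first series are
  nonnegative, and all terms of the second one from \<open>k = 1\<close> on are nonpositive, so, setting
  the constant term aside, the partial sums are dominated by their integrable limit.\<close>

section \<open>Termwise integration of series with nonnegative terms\<close>

lemma sums_integral_nonneg: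
  fixes f :: "nat \<Rightarrow> 'a \<Rightarrow> real"
  assumes f: "\<And>n. f n \<in> borel_measurable M" and g: "integrable M g"
    and nonneg: "\<And>n x. 0 \<le> f n x" and sums: "\<And>x. (\<lambda>n. f n x) sums g x"
  shows "(\<lambda>n. \<integral>x. f n x \<partial>M) sums (\<integral>x. g x \<partial>M)"
proof -
  have le: "(\<Sum>i<n. f i x) \<le> g x" for n x
    using sum_le_suminf[of "\<lambda>n. f n x" "{..<n}"] sums[of x] nonneg by (auto simp: sums_iff)
  \<comment> \<open>A single term is at most the partial sum ending with it, hence at most
    \<open>g\<close>.\<close>
  have int: "integrable M (f n)" for n
  proof (rule Bochner_Integration.integrable_bound[OF g f])
    show "AE x in M. norm (f n x) \<le> norm (g x)"
    proof (rule AE_I2)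
      fix x
      have "f n x \<le> (\<Sum>i<Suc n. f i x)"
        by (rule member_le_sum) (auto simp: nonneg)
      also have "\<dots> \<le> g x" by (rule le)
      finally show "norm (f n x) \<le> norm (g x)" using nonneg[of n x] by simp
    qed
  qed
  \<comment> \<open>Partial sums of nonnegative terms stay below their limit, so \<open>g\<close>
    itself serves as the dominating function.\<close>
  have "(\<lambda>n. \<integral>x. (\<Sum>i<n. f i x) \<partial>M) \<longlonglongrightarrow> (\<integral>x. g x \<partial>M)"
  proof (rule integral_dominated_convergence[where w = g])
    show "AE x in M. norm (\<Sum>i<n. f i x) \<le> g x" for n
      using le[of _ n] by (auto simp: sum_nonneg nonneg)
    show "AE x in M. (\<lambda>n. \<Sum>i<n. f i x) \<longlonglongrightarrow> g x"
      using sums by (auto simp: sums_def)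
  qed (use f g in \<open>auto intro!: borel_measurable_sum\<close>)
  then show ?thesis
    using int by (simp add: sums_def)
qed

section \<open>The Gamma density without its normalising constant\<close>

definition gamma_kernel :: "real \<Rightarrow> real \<Rightarrow> real \<Rightarrow> real" where
  "gamma_kernel a b u = indicator {0<..} u * (u powr (a - 1) * exp (- b * u))"

lemma gamma_kernel_measurable [measurable]: "gamma_kernel a b \<in> borel_measurable borel"
  unfolding gamma_kernel_def by measurable

lemma gamma_kernel_nonneg: "0 \<le> gamma_kernel a b u"
  by (simp add: gamma_kernel_def)

lemma gamma_density_eq: "gamma_density a b u = b powr a / Gamma a * gamma_kernel a b u"
  by (simp add: gamma_density_def gamma_kernel_def)

text \<open>The substitution t = b * u reduces this to Euler's integral for \<open>Gamma a\<close>.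
  The factor \<open>b powr (1 - a)\<close> cancels the power of b that the substitution
  produces.\<close>

lemma integrable_gamma_kernel:
  assumes "a > 0" "b > 0"
  shows "integrable lborel (gamma_kernel a b)"
proof -
  define g :: "real \<Rightarrow> real" where "g = (\<lambda>t. indicator {0..} t * t powr (a - 1) / exp t)"
  have "integrable lborel g"
  proof (rule integrableI_nonneg)
    show "(\<integral>\<^sup>+t. ennreal (g t) \<partial>lborel) < \<infinity>"
      unfolding g_def Gamma_conv_nn_integral_real[OF \<open>a > 0\<close>, symmetric] by simp
  qed (auto simp: g_def)
  then have "integrable lborel (\<lambda>u. b powr (1 - a) * g (0 + b * u))"
    using \<open>b > 0\<close> by (intro integrable_mult_right lborel_integrable_real_affine) auto
  moreover have "b powr (1 - a) * g (0 + b * u) = gamma_kernel a b u" for u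
  proof (cases "u > 0")
    case True
    then have "b powr (1 - a) * (b * u) powr (a - 1) = (b powr (1 - a) * b powr (a - 1)) * u powr (a - 1)"
      using \<open>b > 0\<close> by (simp add: powr_mult)
    also have "b powr (1 - a) * b powr (a - 1) = 1"
      using \<open>b > 0\<close> by (simp flip: powr_add)
    finally show ?thesis
      using True \<open>b > 0\<close> by (simp add: g_def gamma_kernel_def exp_minus field_simps)
  next
    \<comment> \<open>The indicators of \<open>{0..}\<close> and \<open>{0<..}\<close> differ only
      at 0, where \<open>0 powr (a - 1)\<close> is 0 by convention.\<close>
    case False
    then show ?thesis
      using \<open>b > 0\<close> by (cases "u = 0") (auto simp: g_def gamma_kernel_def indicator_def zero_le_mult_iff)
  qed
  ultimately show ?thesis by (simp only:)
qed

text \<open>The indicator inside the kernel turns the half-line integral into one over the whole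
  line, so that later identities between integrands have content only for u > 0.\<close>

lemma kummer_U_eq:
  "kummer_U a b z = 1 / Gamma a * (\<integral>u. gamma_kernel a z u * (1 + u) powr (b - a - 1) \<partial>lborel)"
  by (simp add: kummer_U_def set_lebesgue_integral_def gamma_kernel_def mult_ac)

section \<open>Terms of both series as integrals against one kernel\<close>

lemma C1_term_eq:
  assumes "a > 0"
  shows "C1_term a b n =
    (\<integral>u. gamma_kernel a b u * ((u / (1 + u)) ^ Suc n / real (Suc n)) \<partial>lborel)"
proof -
  define k where "k = real (Suc n)"
  \<comment> \<open>The exponent of 1 + u is -k, and raising the shape by k contributes u^k;
    together they form the k-th power of u / (1 + u).\<close>
  have "gamma_kernel (k + a) b u * (1 + u) powr (1 + a - (k + a) - 1)
      = gamma_kernel a b u * (u / (1 + u)) ^ Suc n" for u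
  proof (cases "u > 0")
    case True
    have "u powr (k + a - 1) = u powr (a - 1) * u ^ Suc n"
    proof -
      have "u powr (k + a - 1) = u powr ((a - 1) + k)"
        by (simp add: algebra_simps)
      also have "\<dots> = u powr (a - 1) * u powr k"
        by (rule powr_add)
      also have "u powr k = u ^ Suc n"
        unfolding k_def using True by (rule powr_realpow)
      finally show ?thesis .
    qed
    moreover have "(1 + u) powr (1 + a - (k + a) - 1) = 1 / (1 + u) ^ Suc n"
    proof -
      have "(1 + u) powr (1 + a - (k + a) - 1) = 1 / (1 + u) powr k"
        by (simp add: powr_minus_divide)
      also have "(1 + u) powr k = (1 + u) ^ Suc n"
        unfolding k_def using True by (intro powr_realpow) simp
      finally show ?thesis .
    qed
    ultimately show ?thesis
      by (simp add: gamma_kernel_def power_divide del: power_Suc)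
  qed (simp add: gamma_kernel_def)
  \<comment> \<open>A nonzero \<open>Gamma (k + a)\<close> cancels the normalisation 1 /
    \<open>Gamma (k + a)\<close> of the Kummer function.\<close>
  moreover have "k > 0" "Gamma (k + a) > 0"
    using assms by (auto simp: k_def intro!: add_pos_pos)
  ultimately have "C1_term a b n = (\<integral>u. gamma_kernel a b u * (u / (1 + u)) ^ Suc n \<partial>lborel) / k"
    unfolding C1_term_def Let_def kummer_U_eq k_def[symmetric] by (simp only:) simp
  then show ?thesis
    by (simp add: k_def del: power_Suc of_nat_Suc)
qed

text \<open>The exponent of 1 + u collapses to -2k. No Gamma factor in the term offsets the Kummer
  normalisation, so the division by \<open>Gamma a\<close> remains.\<close>

lemma C2_term_eq:
  "C2_term a b k =
    (\<integral>u. gamma_kernel a b u * (((1 / 2) gchoose k) * (- (1 / (1 + u)\<^sup>2)) ^ k) \<partial>lborel) / Gamma a"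
proof -
  have "gamma_kernel a b u * (1 + u) powr (1 - 2 * real k + a - a - 1) * (((1 / 2) gchoose k) * (-1) ^ k)
      = gamma_kernel a b u * (((1 / 2) gchoose k) * (- (1 / (1 + u)\<^sup>2)) ^ k)" for u
  proof (cases "u > 0")
    case True
    have "(1 + u) powr (1 - 2 * real k + a - a - 1) = 1 / (1 + u) ^ (2 * k)"
    proof -
      have "(1 + u) powr (1 - 2 * real k + a - a - 1) = 1 / (1 + u) powr (real (2 * k))"
        by (simp add: powr_minus_divide)
      also have "(1 + u) powr (real (2 * k)) = (1 + u) ^ (2 * k)"
        using True by (intro powr_realpow) simp
      finally show ?thesis .
    qed
    then show ?thesis
      by (simp add: power_mult power_divide power_minus[of "1 / (1 + u)\<^sup>2"] power_one_over)
  qed (simp add: gamma_kernel_def)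
  then have "(\<integral>u. gamma_kernel a b u * (1 + u) powr (1 - 2 * real k + a - a - 1) \<partial>lborel)
      * (((1 / 2) gchoose k) * (-1) ^ k)
      = (\<integral>u. gamma_kernel a b u * (((1 / 2) gchoose k) * (- (1 / (1 + u)\<^sup>2)) ^ k) \<partial>lborel)"
    \<comment> \<open>Constants move through the Bochner integral without an integrability
      condition, because non-integrable functions have integral 0.\<close>
    by (simp only: integral_mult_left_zero[symmetric])
  then show ?thesis
    by (simp add: C2_term_def kummer_U_eq mult_ac)
qed

section \<open>Pointwise expansions of the logarithm and the square root\<close>

lemma ln_one_plus_sums:
  fixes u :: real
  assumes "u > 0"
  shows "(\<lambda>n. (u / (1 + u)) ^ Suc n / real (Suc n)) sums ln (1 + u)"
proof -
  \<comment> \<open>Writing ln (1 + u) as - ln (1 - x) with x = u / (1 + u) keeps x below 1 for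
    every u > 0, whereas the power series in u itself diverges for u > 1.\<close>
  have "\<bar>- (u / (1 + u))\<bar> < 1"
    using assms by simp
  then have "(\<lambda>n. - ((u / (1 + u)) ^ n) / real n) sums ln (1 + - (u / (1 + u)))"
    using ln_series'[of "- (u / (1 + u))"] by simp
  moreover have "1 + - (u / (1 + u)) = inverse (1 + u)"
    using assms by (simp add: field_simps)
  ultimately have "(\<lambda>n. (u / (1 + u)) ^ n / real n) sums ln (1 + u)"
    using assms sums_minus by (fastforce simp: ln_inverse)
  \<comment> \<open>The summand at n = 0 is a division by zero, hence 0, and dropping it leaves the
    sum unchanged.\<close>
  then show ?thesis
    using sums_Suc_iff[of "\<lambda>n. (u / (1 + u)) ^ n / real n" "ln (1 + u)"] by simp
qed

text \<open>The first value is -1/2, and each next one arises by the positive factor (k + 1/2) / (k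
  + 2).\<close>

lemma gbinomial_half_Suc_sign: "((1 / 2 :: real) gchoose Suc k) * (- 1) ^ Suc k \<le> 0"
proof (induction k)
  case (Suc k)
  have "(1 / 2 :: real) gchoose Suc (Suc k) = ((1 / 2) gchoose Suc k) * ((1 / 2 - real (Suc k)) / real (Suc (Suc k)))"
    by (simp add: gbinomial_prod_rev field_simps)
  then have "((1 / 2 :: real) gchoose Suc (Suc k)) * (- 1) ^ Suc (Suc k)
      = (((1 / 2) gchoose Suc k) * (- 1) ^ Suc k) * ((real (Suc k) - 1 / 2) / real (Suc (Suc k)))"
    by (simp only:) (simp add: add_divide_distrib diff_divide_distrib algebra_simps)
  also have "\<dots> \<le> 0"
    by (rule mult_nonpos_nonneg[OF Suc.IH]) auto
  finally show ?case .
qed simp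

lemma sqrt_one_minus_sums:
  fixes t :: real
  assumes "0 \<le> t" "t < 1"
  shows "(\<lambda>k. ((1 / 2) gchoose k) * (- t) ^ k) sums sqrt (1 - t)"
  using gen_binomial_real[of "- t" "1 / 2"] assms by (simp add: powr_half_sqrt)

section \<open>The capacity series\<close>

lemma integrable_gamma_kernel_ln:
  assumes "a > 0" "b > 0"
  shows "integrable lborel (\<lambda>u. gamma_kernel a b u * ln (1 + u))"
proof (rule Bochner_Integration.integrable_bound[OF integrable_gamma_kernel[of "a + 1" b]])
  show "AE u in lborel. norm (gamma_kernel a b u * ln (1 + u)) \<le> norm (gamma_kernel (a + 1) b u)"
  proof (rule AE_I2)
    fix u :: real
    show "norm (gamma_kernel a b u * ln (1 + u)) \<le> norm (gamma_kernel (a + 1) b u)"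
    proof (cases "u > 0")
      case True
      \<comment> \<open>Since ln (1 + u) \<le> u, and a factor u raises the shape by one, the kernel
        of shape a + 1 is an integrable bound.\<close>
      then have "gamma_kernel (a + 1) b u = gamma_kernel a b u * u"
        by (simp add: gamma_kernel_def powr_diff)
      moreover have "0 \<le> ln (1 + u)" "ln (1 + u) \<le> u"
        using True by (auto intro: ln_add_one_self_le_self)
      ultimately show ?thesis
        using True gamma_kernel_nonneg[of a b u] by (auto simp: abs_mult intro: mult_left_mono)
    qed (simp add: gamma_kernel_def)
  qed
qed (use assms in auto)

lemma C1_term_sums:
  assumes "a > 0" "b > 0"
  shows "C1_term a b sums (\<integral>u. gamma_kernel a b u * ln (1 + u) \<partial>lborel)"
proof -
  have "(\<lambda>n. \<integral>u. gamma_kernel a b u * ((u / (1 + u)) ^ Suc n / real (Suc n)) \<partial>lborel)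
      sums (\<integral>u. gamma_kernel a b u * ln (1 + u) \<partial>lborel)"
  proof (rule sums_integral_nonneg)
    show "0 \<le> gamma_kernel a b u * ((u / (1 + u)) ^ Suc n / real (Suc n))" for n u
      by (cases "u > 0") (auto simp: gamma_kernel_def)
    show "(\<lambda>n. gamma_kernel a b u * ((u / (1 + u)) ^ Suc n / real (Suc n)))
        sums (gamma_kernel a b u * ln (1 + u))" for u
    proof (cases "u > 0")
      case True
      then show ?thesis by (intro sums_mult ln_one_plus_sums)
    qed (simp add: gamma_kernel_def)
  qed (use assms in \<open>auto intro: integrable_gamma_kernel_ln\<close>)
  then show ?thesis
    by (simp only: C1_term_eq[OF \<open>a > 0\<close>, symmetric])
qed

section \<open>The dispersion series\<close>

lemma integrable_gamma_kernel_sqrt: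
  assumes "a > 0" "b > 0"
  shows "integrable lborel (\<lambda>u. gamma_kernel a b u * sqrt (1 - 1 / (1 + u)\<^sup>2))"
proof (rule Bochner_Integration.integrable_bound[OF integrable_gamma_kernel[of a b]])
  show "AE u in lborel. norm (gamma_kernel a b u * sqrt (1 - 1 / (1 + u)\<^sup>2)) \<le> norm (gamma_kernel a b u)"
  proof (rule AE_I2)
    fix u :: real
    show "norm (gamma_kernel a b u * sqrt (1 - 1 / (1 + u)\<^sup>2)) \<le> norm (gamma_kernel a b u)"
      by (cases "u > 0") (auto simp: gamma_kernel_def abs_mult intro!: mult_left_le)
  qed
qed (use assms in auto)

text \<open>Only the term at k = 0 has the opposite sign. The negated tail is therefore a series of
  nonnegative functions with integrable sum \<open>gamma_kernel a b u - h u\<close>, to which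
  termwise integration applies.\<close>

lemma C2_term_sums:
  assumes "a > 0" "b > 0"
  shows "C2_term a b sums ((\<integral>u. gamma_kernel a b u * sqrt (1 - 1 / (1 + u)\<^sup>2) \<partial>lborel) / Gamma a)"
proof -
  define f where "f = (\<lambda>k u. gamma_kernel a b u * (((1 / 2) gchoose k) * (- (1 / (1 + u)\<^sup>2)) ^ k))"
  define h where "h = (\<lambda>u. gamma_kernel a b u * sqrt (1 - 1 / (1 + u)\<^sup>2))"
  have f0: "f 0 = gamma_kernel a b"
    by (simp add: f_def)
  have int: "integrable lborel (gamma_kernel a b)" "integrable lborel h"
    using assms by (simp_all add: h_def integrable_gamma_kernel integrable_gamma_kernel_sqrt)
  have "(\<lambda>k. \<integral>u. - f (Suc k) u \<partial>lborel) sums (\<integral>u. gamma_kernel a b u - h u \<partial>lborel)"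
  proof (rule sums_integral_nonneg)
    show "0 \<le> - f (Suc k) u" for k u
    proof -
      have "- f (Suc k) u = - (((1 / 2) gchoose Suc k) * (- 1) ^ Suc k)
          * (gamma_kernel a b u * (1 / (1 + u)\<^sup>2) ^ Suc k)"
        by (simp only: f_def power_minus[of "1 / (1 + u)\<^sup>2"]) (simp add: algebra_simps)
      also have "\<dots> \<ge> 0"
        using gbinomial_half_Suc_sign[of k] gamma_kernel_nonneg[of a b u]
        by (intro mult_nonneg_nonneg) auto
      finally show ?thesis .
    qed
    show "(\<lambda>k. - f (Suc k) u) sums (gamma_kernel a b u - h u)" for u
    proof -
      have "(\<lambda>k. f k u) sums h u"
      \<comment> \<open>For u > 0 the argument 1 / (1 + u)^2 lies strictly between 0 and 1; for all
        other u the kernel makes both sides 0.\<close>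
      proof (cases "u > 0")
        case True
        then show ?thesis
          unfolding f_def h_def by (intro sums_mult sqrt_one_minus_sums) auto
      qed (simp add: f_def h_def gamma_kernel_def)
      then have "(\<lambda>k. f (Suc k) u) sums (h u - gamma_kernel a b u)"
        using sums_Suc_iff[of "\<lambda>k. f k u" "h u - gamma_kernel a b u"] by (simp add: f0)
      from sums_minus[OF this] show ?thesis by simp
    qed
    show "(\<lambda>u. - f (Suc k) u) \<in> borel_measurable lborel" for k
      unfolding f_def by measurable
  qed (use int in auto)
  then have "(\<lambda>k. \<integral>u. f (Suc k) u \<partial>lborel)
      sums ((\<integral>u. h u \<partial>lborel) - (\<integral>u. gamma_kernel a b u \<partial>lborel))"
    using sums_minus int by fastforce
  \<comment> \<open>Restoring the constant term \<open>f 0\<close> cancels the subtracted kernel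
    integral.\<close>
  then have "(\<lambda>k. \<integral>u. f k u \<partial>lborel) sums (\<integral>u. h u \<partial>lborel)"
    using sums_Suc_iff[of "\<lambda>k. \<integral>u. f k u \<partial>lborel"] by (simp add: f0)
  from sums_divide[OF this, of "Gamma a"] show ?thesis
    by (simp add: f_def h_def C2_term_eq[abs_def])
qed

section \<open>Expectations under the Gamma law\<close>

lemma sqrt_dispersion: "sqrt (dispersion g) = sqrt (1 - 1 / (1 + g)\<^sup>2) / ln 2"
  by (simp add: dispersion_def real_sqrt_mult log_def)

theorem theorem2:
  fixes M :: "'a measure" and \<gamma> :: "'a \<Rightarrow> real" and \<alpha> \<beta> \<epsilon> :: real and r :: nat
  assumes "prob_space M"
    and "\<alpha> > 0" and "\<beta> > 0" and "r > 0" and "0 < \<epsilon>" and "\<epsilon> < 1"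
    and "distributed M lborel \<gamma> (\<lambda>u. ennreal (gamma_density \<alpha> \<beta> u))"
  shows "integrable M (\<lambda>\<omega>. achievable_rate r \<epsilon> (\<gamma> \<omega>)) \<and>
    integrable M (\<lambda>\<omega>. log 2 (1 + \<gamma> \<omega>)) \<and>
    integrable M (\<lambda>\<omega>. sqrt (dispersion (\<gamma> \<omega>))) \<and>
    summable (C1_term \<alpha> \<beta>) \<and>
    summable (C2_term \<alpha> \<beta>) \<and>
    average_rate M \<gamma> r \<epsilon> =
      (\<integral>\<omega>. log 2 (1 + \<gamma> \<omega>) \<partial>M)
      - Q_inv \<epsilon> / sqrt (real r) * (\<integral>\<omega>. sqrt (dispersion (\<gamma> \<omega>)) \<partial>M) \<and>
    (\<integral>\<omega>. log 2 (1 + \<gamma> \<omega>) \<partial>M) =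
      \<beta> powr \<alpha> / (Gamma \<alpha> * ln 2) * (\<Sum>n. C1_term \<alpha> \<beta> n) \<and>
    (\<integral>\<omega>. sqrt (dispersion (\<gamma> \<omega>)) \<partial>M) =
      \<beta> powr \<alpha> / ln 2 * (\<Sum>k. C2_term \<alpha> \<beta> k) \<and>
    average_rate M \<gamma> r \<epsilon> =
      \<beta> powr \<alpha> / (Gamma \<alpha> * ln 2) * (\<Sum>n. C1_term \<alpha> \<beta> n)
      - Q_inv \<epsilon> * \<beta> powr \<alpha> / (sqrt (real r) * ln 2) * (\<Sum>k. C2_term \<alpha> \<beta> k)"
proof -
  note dist = assms(7)
  have c_pos: "0 < \<beta> powr \<alpha> / Gamma \<alpha>"
    using assms by simp
  then have density_nonneg: "0 \<le> gamma_density \<alpha> \<beta> u" for u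
    using gamma_kernel_nonneg[of \<alpha> \<beta> u] unfolding gamma_density_eq by (intro mult_nonneg_nonneg) auto
  \<comment> \<open>Expectations of functions of \<gamma> become kernel integrals by change of
    variables, with the normalising constant of the density pulled out.\<close>
  have transfer_integrable: "integrable M (\<lambda>\<omega>. g (\<gamma> \<omega>))"
    and transfer_integral: "(\<integral>\<omega>. g (\<gamma> \<omega>) \<partial>M) =
      \<beta> powr \<alpha> / Gamma \<alpha> * (\<integral>u. gamma_kernel \<alpha> \<beta> u * g u \<partial>lborel)"
    if "integrable lborel (\<lambda>u. gamma_kernel \<alpha> \<beta> u * g u)" "g \<in> borel_measurable borel" for g
  proof -
    have "integrable lborel (\<lambda>u. gamma_density \<alpha> \<beta> u * g u)"
      unfolding gamma_density_eq mult.assoc by (intro integrable_mult_right that)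
    then show "integrable M (\<lambda>\<omega>. g (\<gamma> \<omega>))"
      using distributed_integrable[OF dist, of g] that density_nonneg by simp
    have "(\<integral>u. gamma_density \<alpha> \<beta> u * g u \<partial>lborel) = (\<integral>\<omega>. g (\<gamma> \<omega>) \<partial>M)"
      using that density_nonneg by (intro distributed_integral[OF dist]) auto
    then show "(\<integral>\<omega>. g (\<gamma> \<omega>) \<partial>M) =
        \<beta> powr \<alpha> / Gamma \<alpha> * (\<integral>u. gamma_kernel \<alpha> \<beta> u * g u \<partial>lborel)"
      by (simp add: gamma_density_eq mult.assoc)
  qed

  note ln_int = integrable_gamma_kernel_ln[OF \<open>\<alpha> > 0\<close> \<open>\<beta> > 0\<close>]
  note sqrt_int = integrable_gamma_kernel_sqrt[OF \<open>\<alpha> > 0\<close> \<open>\<beta> > 0\<close>]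
  note C1 = C1_term_sums[OF \<open>\<alpha> > 0\<close> \<open>\<beta> > 0\<close>]
  note C2 = C2_term_sums[OF \<open>\<alpha> > 0\<close> \<open>\<beta> > 0\<close>]

  have int1: "integrable M (\<lambda>\<omega>. log 2 (1 + \<gamma> \<omega>))"
    using transfer_integrable[OF ln_int] by (simp add: log_def)
  have int2: "integrable M (\<lambda>\<omega>. sqrt (dispersion (\<gamma> \<omega>)))"
    using transfer_integrable[OF sqrt_int] by (simp add: sqrt_dispersion)
  have E1: "(\<integral>\<omega>. log 2 (1 + \<gamma> \<omega>) \<partial>M) = \<beta> powr \<alpha> / (Gamma \<alpha> * ln 2) * (\<Sum>n. C1_term \<alpha> \<beta> n)"
    using transfer_integral[OF ln_int] sums_unique[OF C1] by (simp add: log_def)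
  \<comment> \<open>Here 1 / \<open>Gamma \<alpha>\<close> is absorbed by the Kummer functions; in
    \<open>E1\<close> it stays in front, their normalisation having been cancelled term by
    term.\<close>
  have E2: "(\<integral>\<omega>. sqrt (dispersion (\<gamma> \<omega>)) \<partial>M) = \<beta> powr \<alpha> / ln 2 * (\<Sum>k. C2_term \<alpha> \<beta> k)"
    using transfer_integral[OF sqrt_int] sums_unique[OF C2, symmetric] by (simp add: sqrt_dispersion)
  have rate: "achievable_rate r \<epsilon> g = log 2 (1 + g) - Q_inv \<epsilon> / sqrt (real r) * sqrt (dispersion g)" for g
    by (simp add: achievable_rate_def capacity_def real_sqrt_divide)
  have int: "integrable M (\<lambda>\<omega>. achievable_rate r \<epsilon> (\<gamma> \<omega>))"
    unfolding rate by (intro Bochner_Integration.integrable_diff integrable_mult_right int1 int2)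
  have E: "average_rate M \<gamma> r \<epsilon> = (\<integral>\<omega>. log 2 (1 + \<gamma> \<omega>) \<partial>M)
      - Q_inv \<epsilon> / sqrt (real r) * (\<integral>\<omega>. sqrt (dispersion (\<gamma> \<omega>)) \<partial>M)"
    unfolding average_rate_def rate
    by (subst Bochner_Integration.integral_diff[OF int1 integrable_mult_right[OF int2]])
      (simp only: integral_mult_right_zero)
  show ?thesis
    using int int1 int2 E E1 E2 sums_summable[OF C1] sums_summable[OF C2] by simp
qed

end
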